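(* Assume (A1)–(A4), let $\{x_t\}$, $\{\lambda_t\}$ be generated by the M-CRM (Algorithm 1), and let $x^*$ be the limit point of $\{x_t\}$ (under these assumptions the whole sequence $\{x_t\}$ converges). Let $t_1\in\mathbb N$ be an index such that, for all $t\ge t_1$ and all $\lambda\in\mathbb R^m_+$ with $\sum_j\lambda_j=1$, $$\|\Delta x_{t+1}\|\le\frac4\mu\Big\|\sum_{j\in\mathcal J}\lambda_j\nabla F_j(x_t)\Big\|\quad\text{and}\quad \|g_{t+1}\|\le C\|g_t\|^2,$$ where $C:=8(L+\alpha\sigma_{\max}+2\theta)/\mu^2+4\alpha\bar\kappa_H\zeta/\mu$ and $\sigma_{\max}:=\sigma_1+2[L+3\alpha(2\bar\kappa_G+\bar\kappa_H)]$ (such an index exists under these assumptions). Then there exist $C_1,C_2,C_3>0$ such that, for all $t\ge t_1$, $$\|x_{t+1}-x^*\|\le C_1\|g_{t+1}\|,$$ $$\|\tilde g_t\|\le C_2\min\{\|\Delta x_{t+1}\|,\|x_t-x^*\|\},$$ $$\|x_{t+1}-x^*\|\le C_3\|g_t\|\,\|x_t-x^*\|,$$ where $\tilde g_t:=\sum_{j\in\mathcal J}(\lambda_{t+1})_j\nabla F_j(x_t)$. As a consequence, $\{x_t\}$ is superlinearly convergent to $x^*$.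
   Context: Setting: $F=(F_1,\dots,F_m):\mathbb R^n\to\mathbb R^m$ is twice continuously differentiable, $\mathcal J=\{1,\dots,m\}$; $\|\cdot\|$ is the Euclidean norm and the induced operator norm. Given approximations $\nabla\bar F_j(x)\in\mathbb R^n$ of $\nabla F_j(x)$ and symmetric $\nabla^2\bar F_j(x)\in\mathbb R^{n\times n}$ of $\nabla^2F_j(x)$, set $E^G_j(x):=\nabla F_j(x)-\nabla\bar F_j(x)$, $E^H_j(x):=\nabla^2F_j(x)-\nabla^2\bar F_j(x)$, and for $\sigma>0$ $$M^j_{x,\sigma}(y):=\langle\nabla\bar F_j(x),y-x\rangle+\tfrac12\langle\nabla^2\bar F_j(x)(y-x),y-x\rangle+\tfrac{\sigma}{6}\|y-x\|^3,\qquad M_{x,\sigma}(y):=\max_{j\in\mathcal J}M^j_{x,\sigma}(y).$$ Algorithm 1 (M-CRM). Step 0: choose $x_0,x_1\in\mathbb R^n$, $\sigma_1>0$, $\theta\ge0$, $\alpha>1$, $\bar\kappa_G,\bar\kappa_H\ge0$; set $t:=1$. Step 1: let $i\ge0$ be the smallest integer with $\alpha^{i-1}\sigma_t\ge\sigma_1$. Step 1.1: for every $j$ choose $\nabla\bar F_j(x_t),\nabla^2\bar F_j(x_t)$ with $\|E^G_j(x_t)\|\le\frac{\bar\kappa_G}{\alpha^{i-1}}\|x_t-x_{t-1}\|^2$ and $\|E^H_j(x_t)\|\le\frac{\bar\kappa_H}{\alpha^{i-1}}\|x_t-x_{t-1}\|$. Step 1.2: compute $(x^+_{t,i},\lambda^+_{t,i})\in\mathbb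 R^n\times\mathbb R^m_+$ with $M_{x_t,\alpha^i\sigma_t}(x^+_{t,i})\le0$, $\sum_j(\lambda^+_{t,i})_j=1$, and $\big\|\sum_j(\lambda^+_{t,i})_j\nabla M^j_{x_t,\alpha^i\sigma_t}(x^+_{t,i})\big\|\le\theta\|x^+_{t,i}-x_t\|^2$. Step 1.3: if $F_j(x_t)-F_j(x^+_{t,i})\ge\frac{\alpha^i\sigma_t}{12}\|x^+_{t,i}-x_t\|^3-\frac{\sigma_t}{12}\|x_t-x_{t-1}\|^3$ for all $j\in\mathcal J$, set $i_t=i$ and go to Step 2; otherwise set $i:=i+1$ and go to Step 1.1. Step 2: set $x_{t+1}=x^+_{t,i_t}$, $\lambda_{t+1}=\lambda^+_{t,i_t}$, $\sigma_{t+1}=\alpha^{i_t-1}\sigma_t$, $t:=t+1$, and go to Step 1. Notation: $g_t:=\sum_{j\in\mathcal J}(\lambda_t)_j\nabla F_j(x_t)$, $\Delta x_t:=x_t-x_{t-1}$; for $t=1$, $\lambda_1\in\mathbb R^m_+$ is any fixed vector with $\sum_j(\lambda_1)_j=1$. (A1): for every $j\in\mathcal J$, $\|\nabla^2F_j(y)-\nabla^2F_j(z)\|\le L_j\|y-z\|$ for all $y,z\in\mathbb R^n$; $L:=\max_{j}L_j$. (A2): for every $j\in\mathcal J$ there is $F_j^*\in\mathbb R$ with $F_j(y)\ge F_j^*$ for all $y$. (A3): there exist $\mu>0$ and an index $t_0$ such that, for every $j\in\mathcal J$, $\nabla^2F_j(x)\succeq\mu I$ whenever $F_j(x)\le F_j(x_{t_0})+\frac{\sigma_1}{12}\|x_1-x_0\|^3$.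 (A4): for every $j\in\mathcal J$, $\nabla\bar F_j=\nabla F_j$, and at each inner iteration $i$ of each outer iteration $t$ the Hessian approximation satisfies $\|E^H_j(x_t)\|\le\frac{\bar\kappa_H}{\alpha^{i-1}}\min\{\|\Delta x_t\|,\zeta\|g_t\|\}$, where $\zeta>0$ is a constant. Superlinear convergence of $\{x_t\}$ to $x^*$ means: there is a sequence $\epsilon_t\to0$ with $\|x_{t+1}-x^*\|\le\epsilon_t\|x_t-x^*\|$ for all large $t$. *)

theory Defs
  imports "HOL-Analysis.Analysis"
begin

definition gradient :: "(real^'n \<Rightarrow> real) \<Rightarrow> real^'n \<Rightarrow> real^'n" where
  "gradient f x = (THE g. GDERIV f x :> g)"

lemma gradient_eqI: "GDERIV f x :> g \<Longrightarrow> gradient f x = g"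
  unfolding gradient_def gderiv_def
  by (rule the_equality, assumption)
     (metis has_derivative_unique inner_commute vector_eq_rdot)

definition hessian :: "(real^'n \<Rightarrow> real) \<Rightarrow> real^'n \<Rightarrow> real^'n^'n" where
  "hessian f x = matrix (frechet_derivative (gradient f) (at x))"

definition twice_cont_differentiable :: "(real^'n \<Rightarrow> real) \<Rightarrow> bool" where
  "twice_cont_differentiable f \<longleftrightarrow>
     (\<forall>x. f differentiable (at x)) \<and> (\<forall>x. gradient f differentiable (at x)) \<and>
     continuous_on UNIV (hessian f)"

text \<open>The operator norm induced by the Euclidean norm; \<^const>\<open>norm\<close> on the type
  of matrices is the Frobenius norm.\<close>
definition opnorm :: "real^'n^'n \<Rightarrow> real" where
  "opnorm A = onorm (\<lambda>v. A *v v)"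

text \<open>The Loewner order; only used for symmetric matrices.\<close>
definition loewner_le :: "real^'n^'n \<Rightarrow> real^'n^'n \<Rightarrow> bool" where
  "loewner_le A B \<longleftrightarrow> (\<forall>v. 0 \<le> ((B - A) *v v) \<bullet> v)"

definition std_simplex :: "(real^'m) set" where
  "std_simplex = {l. (\<forall>j. 0 \<le> l $ j) \<and> (\<Sum>j\<in>UNIV. l $ j) = 1}"

definition obj :: "(real^'n \<Rightarrow> real^'m) \<Rightarrow> 'm \<Rightarrow> real^'n \<Rightarrow> real" where
  "obj F j = (\<lambda>y. F y $ j)"

definition weighted_grad :: "(real^'n \<Rightarrow> real^'m) \<Rightarrow> real^'m \<Rightarrow> real^'n \<Rightarrow> real^'n" where
  "weighted_grad F l x = (\<Sum>j\<in>UNIV. l $ j *\<^sub>R gradient (obj F j) x)"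

definition model :: "real^'n \<Rightarrow> real^'n^'n \<Rightarrow> real^'n \<Rightarrow> real \<Rightarrow> real^'n \<Rightarrow> real" where
  "model G H x s y =
     G \<bullet> (y - x) + 1/2 * ((H *v (y - x)) \<bullet> (y - x)) + s / 6 * norm (y - x) ^ 3"

definition max_model ::
  "('m \<Rightarrow> real^'n) \<Rightarrow> ('m \<Rightarrow> real^'n^'n) \<Rightarrow> real^'n \<Rightarrow> real \<Rightarrow> real^'n \<Rightarrow> real" where
  "max_model G H x s y = (MAX j. model (G j) (H j) x s y)"

text \<open>\<open>x t\<close>, \<open>\<sigma> t\<close>, \<open>lam t\<close> are the outer iterates and \<open>it t\<close> is the accepted inner index of
  outer iteration \<open>t\<close>. The arguments \<open>t\<close>, \<open>i\<close> of the other sequences are the outer and inner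
  iteration: \<open>gb t i j\<close> and \<open>Hb t i j\<close> are the approximate gradient and Hessian of the \<open>j\<close>-th
  objective at \<open>x t\<close> chosen there (they are chosen anew in every inner iteration), and
  \<open>xp t i\<close>, \<open>lp t i\<close> are the trial point and multiplier. Outer iterations start at
  \<open>t = 1\<close>, so \<open>\<sigma> 0\<close>, \<open>lam 0\<close> and the inner data for \<open>t = 0\<close> carry no meaning. The exponent
  \<open>i - 1\<close> can be \<open>-1\<close>, hence the integer power.\<close>

definition first_inner :: "real \<Rightarrow> (nat \<Rightarrow> real) \<Rightarrow> nat \<Rightarrow> nat" where
  "first_inner \<alpha> \<sigma> t = (LEAST i. \<alpha> powi (int i - 1) * \<sigma> t \<ge> \<sigma> 1)"

definition inner_iters :: "real \<Rightarrow> (nat \<Rightarrow> real) \<Rightarrow> (nat \<Rightarrow> nat) \<Rightarrow> nat \<Rightarrow> nat set" where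
  "inner_iters \<alpha> \<sigma> it t = {first_inner \<alpha> \<sigma> t .. it t}"

definition step_1_1 ::
  "(real^'n \<Rightarrow> real^'m) \<Rightarrow> real \<Rightarrow> real \<Rightarrow> real \<Rightarrow> nat \<Rightarrow> real^'n \<Rightarrow> real^'n \<Rightarrow>
   ('m \<Rightarrow> real^'n) \<Rightarrow> ('m \<Rightarrow> real^'n^'n) \<Rightarrow> bool" where
  "step_1_1 F \<alpha> \<kappa>G \<kappa>H i xprev xt G H \<longleftrightarrow>
     (\<forall>j. transpose (H j) = H j \<and>
          norm (gradient (obj F j) xt - G j)
            \<le> \<kappa>G / \<alpha> powi (int i - 1) * norm (xt - xprev) ^ 2 \<and>
          opnorm (hessian (obj F j) xt - H j)
            \<le> \<kappa>H / \<alpha> powi (int i - 1) * norm (xt - xprev))"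

text \<open>Here \<open>s\<close> is the regularization parameter of the inner iteration.\<close>
definition step_1_2 ::
  "real \<Rightarrow> real \<Rightarrow> real^'n \<Rightarrow> ('m \<Rightarrow> real^'n) \<Rightarrow> ('m \<Rightarrow> real^'n^'n) \<Rightarrow>
   real^'n \<Rightarrow> real^'m \<Rightarrow> bool" where
  "step_1_2 \<theta> s xt G H y l \<longleftrightarrow>
     max_model G H xt s y \<le> 0 \<and> l \<in> std_simplex \<and>
     norm (\<Sum>j\<in>UNIV. l $ j *\<^sub>R gradient (model (G j) (H j) xt s) y)
       \<le> \<theta> * norm (y - xt) ^ 2"

definition step_1_3 ::
  "(real^'n \<Rightarrow> real^'m) \<Rightarrow> real \<Rightarrow> real \<Rightarrow> nat \<Rightarrow> real^'n \<Rightarrow> real^'n \<Rightarrow> real^'n \<Rightarrow> bool" where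
  "step_1_3 F \<alpha> s i xprev xt y \<longleftrightarrow>
     (\<forall>j. obj F j xt - obj F j y
            \<ge> \<alpha> ^ i * s / 12 * norm (y - xt) ^ 3 - s / 12 * norm (xt - xprev) ^ 3)"

definition M_CRM ::
  "(real^'n \<Rightarrow> real^'m) \<Rightarrow> real \<Rightarrow> real \<Rightarrow> real \<Rightarrow> real \<Rightarrow>
   (nat \<Rightarrow> real^'n) \<Rightarrow> (nat \<Rightarrow> real) \<Rightarrow> (nat \<Rightarrow> real^'m) \<Rightarrow> (nat \<Rightarrow> nat) \<Rightarrow>
   (nat \<Rightarrow> nat \<Rightarrow> 'm \<Rightarrow> real^'n) \<Rightarrow> (nat \<Rightarrow> nat \<Rightarrow> 'm \<Rightarrow> real^'n^'n) \<Rightarrow>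
   (nat \<Rightarrow> nat \<Rightarrow> real^'n) \<Rightarrow> (nat \<Rightarrow> nat \<Rightarrow> real^'m) \<Rightarrow> bool" where
  "M_CRM F \<theta> \<alpha> \<kappa>G \<kappa>H x \<sigma> lam it gb Hb xp lp \<longleftrightarrow>
     \<sigma> 1 > 0 \<and> \<theta> \<ge> 0 \<and> \<alpha> > 1 \<and> \<kappa>G \<ge> 0 \<and> \<kappa>H \<ge> 0 \<and> lam 1 \<in> std_simplex \<and>
     (\<forall>t\<ge>1.
        first_inner \<alpha> \<sigma> t \<le> it t \<and>
        (\<forall>i \<in> inner_iters \<alpha> \<sigma> it t.
           step_1_1 F \<alpha> \<kappa>G \<kappa>H i (x (t - 1)) (x t) (gb t i) (Hb t i) \<and>
           step_1_2 \<theta> (\<alpha> ^ i * \<sigma> t) (x t) (gb t i) (Hb t i) (xp t i) (lp t i) \<and>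
           (step_1_3 F \<alpha> (\<sigma> t) i (x (t - 1)) (x t) (xp t i) \<longleftrightarrow> i = it t)) \<and>
        x (t + 1) = xp t (it t) \<and>
        lam (t + 1) = lp t (it t) \<and>
        \<sigma> (t + 1) = \<alpha> powi (int (it t) - 1) * \<sigma> t)"

definition superlinearly_convergent :: "(nat \<Rightarrow> real^'n) \<Rightarrow> real^'n \<Rightarrow> bool" where
  "superlinearly_convergent x l \<longleftrightarrow>
     (\<exists>\<epsilon>::nat \<Rightarrow> real. \<epsilon> \<longlonglongrightarrow> 0 \<and>
        (\<forall>\<^sub>F t in sequentially. norm (x (t + 1) - l) \<le> \<epsilon> t * norm (x t - l)))"

end

theory Submission
  imports Defs
begin

text \<open>Write \<open>D t = norm (x (t + 1) - x t)\<close>. Failure of Step 1.3 at an inner iteration bounds the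
  regularization parameter in use there, so the sequence \<open>\<sigma>\<close> is bounded. The approximate stationarity in
  Step 1.2 then yields \<open>norm (g (t + 1)) \<le> c * norm (g t) * D t\<close>, and also \<open>g t \<longlonglongrightarrow> 0\<close>. Hence
  \<open>norm (g t)\<close> is eventually halved at each step, and since \<open>D t \<le> 4 / \<mu> * norm (g t)\<close> the
  distance to the limit is telescoped into a multiple of \<open>norm (g t)\<close>. The finitely many early
  indices only affect the constant, because \<open>g t = 0\<close> makes the iterates stationary.
  Combined with \<open>D t \<le> c * norm (x t - xstar)\<close> these estimates give all the rates.\<close>

section \<open>Gradients, Hessians and Taylor estimates\<close>

lemma opnorm_nonneg: "0 \<le> opnorm A"
  unfolding opnorm_def by (rule onorm_pos_le[OF matrix_vector_mul_bounded_linear])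

lemma norm_matrix_vector_le: "norm (A *v v) \<le> opnorm A * norm v"
  unfolding opnorm_def by (rule onorm[OF matrix_vector_mul_bounded_linear])

lemma opnorm_le_add_diff: "opnorm A \<le> opnorm B + opnorm (A - B)"
proof -
  have "opnorm A = onorm (\<lambda>v. B *v v + (A - B) *v v)"
    unfolding opnorm_def by (simp add: matrix_vector_mult_diff_rdistrib)
  also have "\<dots> \<le> opnorm B + opnorm (A - B)"
    unfolding opnorm_def
    by (rule onorm_triangle; rule matrix_vector_mul_bounded_linear)
  finally show ?thesis .
qed

text \<open>The derivative is a linear functional, and its Riesz representer is
  \<open>adjoint f' 1\<close>. This supplies the existence that the definite description in
  \<open>gradient\<close> requires.\<close>

lemma GDERIV_gradient:
  fixes f :: "real^'n \<Rightarrow> real"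
  assumes "f differentiable (at x)"
  shows "GDERIV f x :> gradient f x"
proof -
  obtain f' where f': "(f has_derivative f') (at x)"
    using assms by (auto simp: differentiable_def)
  have "f' h = adjoint f' 1 \<bullet> h" for h
    using adjoint_works[OF has_derivative_linear[OF f'], of h 1] by (simp add: inner_commute)
  then have "GDERIV f x :> adjoint f' 1"
    using has_derivative_eq_rhs[OF f'] unfolding gderiv_def by (simp add: fun_eq_iff inner_commute)
  then show ?thesis
    using gradient_eqI by metis
qed

lemma has_derivative_inner_gradient:
  assumes "twice_cont_differentiable f"
  shows "(f has_derivative (\<lambda>h. h \<bullet> gradient f x)) (at x)"
  using GDERIV_gradient assms unfolding twice_cont_differentiable_def gderiv_def
  by blast

lemma has_derivative_gradient_hessian:
  assumes "twice_cont_differentiable f"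
  shows "(gradient f has_derivative (*v) (hessian f x)) (at x)"
proof -
  have d: "(gradient f has_derivative frechet_derivative (gradient f) (at x)) (at x)"
    using assms unfolding twice_cont_differentiable_def
    by (blast intro: iffD1[OF frechet_derivative_works])
  show ?thesis
    unfolding hessian_def matrix_vector_mul(2)[OF has_derivative_linear[OF d]] by (rule d)
qed

text \<open>The chain rule breaks down at the origin, where the norm is not differentiable. There
  the difference quotient is the squared norm, so the derivative is 0.\<close>

lemma has_derivative_norm_cubed:
  "((\<lambda>v. norm v ^ 3) has_derivative (\<lambda>h. 3 * norm v * (v \<bullet> h))) (at (v :: 'a::real_inner))"
proof (cases "v = 0")
  case True
  have "((\<lambda>y::'a. norm y ^ 2) \<longlongrightarrow> 0) (at 0)"
    by (auto intro!: tendsto_eq_intros)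
  then have "((\<lambda>y::'a. norm y ^ 3 / norm y) \<longlongrightarrow> 0) (at 0)"
    by (rule Lim_transform_eventually)
       (auto simp: eventually_at power3_eq_cube power2_eq_square intro!: exI[of _ 1])
  then show ?thesis
    using True by (simp add: has_derivative_at_within divide_inverse mult.commute)
next
  case False
  have "((\<lambda>v. norm v ^ 3) has_derivative (\<lambda>h. real 3 * (sgn v \<bullet> h) * norm v ^ (3 - 1))) (at v)"
    by (rule has_derivative_power, rule has_derivative_norm[OF False, THEN has_derivative_eq_rhs])
       (simp add: inner_commute)
  then show ?thesis
    by (rule has_derivative_eq_rhs)
       (use False in \<open>simp add: fun_eq_iff sgn_div_norm power2_eq_square\<close>)
qed

text \<open>The product rule gives two terms for the quadratic form; symmetry of \<open>H\<close>
  merges them and cancels the factor 1/2.\<close>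

lemma gradient_model:
  assumes "transpose H = H"
  shows "gradient (model G H x s) y = G + H *v (y - x) + (s / 2 * norm (y - x)) *\<^sub>R (y - x)"
proof (rule gradient_eqI)
  have sym: "(H *v h) \<bullet> v = (H *v v) \<bullet> h" for h v
    using assms by (metis dot_lmul_matrix inner_commute vector_transpose_matrix)
  have sh: "((\<lambda>y. y - x) has_derivative (\<lambda>h. h)) (at y)"
    by (auto intro!: derivative_eq_intros)
  have Hd: "((\<lambda>y. H *v (y - x)) has_derivative (\<lambda>h. H *v h)) (at y)"
    using bounded_linear.has_derivative[OF matrix_vector_mul_bounded_linear sh] .
  have cube: "((\<lambda>y. norm (y - x) ^ 3) has_derivative (\<lambda>h. 3 * norm (y - x) * ((y - x) \<bullet> h))) (at y)"
    using has_derivative_compose[OF sh has_derivative_norm_cubed] .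
  have "(model G H x s has_derivative
      (\<lambda>h. G \<bullet> h + 1/2 * ((H *v (y - x)) \<bullet> h + (H *v h) \<bullet> (y - x))
        + s / 6 * (3 * norm (y - x) * ((y - x) \<bullet> h)))) (at y)"
    unfolding model_def[abs_def]
    by (intro has_derivative_add has_derivative_mult_right has_derivative_inner
        has_derivative_inner_right sh Hd cube)
  then show "GDERIV (model G H x s) y :> G + H *v (y - x) + (s / 2 * norm (y - x)) *\<^sub>R (y - x)"
    unfolding gderiv_def
    by (rule has_derivative_eq_rhs)
       (simp add: fun_eq_iff sym[of _ "y - x"] inner_add_right inner_commute)
qed

section \<open>Taylor estimates for one objective with Lipschitz Hessian\<close>

locale lipschitz_hessian =
  fixes f :: "real^'n \<Rightarrow> real" and K :: real
  assumes C2: "twice_cont_differentiable f"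
    and K_nonneg: "0 \<le> K"
    and lipschitz: "opnorm (hessian f y - hessian f z) \<le> K * norm (y - z)"
begin

text \<open>Mean value inequality for the gradient minus its linear part, whose derivative on the
  segment is a Hessian difference. The constant is K rather than the K/2 of an integral argument,
  which suffices because only the existence of rate constants is claimed.\<close>

lemma gradient_taylor:
  "norm (gradient f y - gradient f x - hessian f x *v (y - x)) \<le> K * norm (y - x) ^ 2"
proof -
  let ?h = "\<lambda>z. gradient f z - hessian f x *v z"
  have d: "(?h has_derivative (*v) (hessian f z - hessian f x)) (at z within S)" for z S
    by (rule has_derivative_at_withinI)
       (auto intro!: derivative_eq_intros has_derivative_gradient_hessian C2
          bounded_linear_imp_has_derivative simp: fun_eq_iff matrix_vector_mult_diff_rdistrib)
  have b: "onorm ((*v) (hessian f z - hessian f x)) \<le> K * norm (y - x)"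
    if "z \<in> closed_segment x y" for z
  proof -
    have "norm (z - x) \<le> norm (y - x)"
      using segment_bound1[OF that] by (simp add: norm_minus_commute)
    then show ?thesis
      using lipschitz[of z x] mult_left_mono[OF _ K_nonneg, of "norm (z - x)" "norm (y - x)"]
      unfolding opnorm_def by linarith
  qed
  have "norm (?h y - ?h x) \<le> K * norm (y - x) * norm (y - x)"
    by (rule differentiable_bound[of "closed_segment x y", OF _ d b]) auto
  then show ?thesis
    by (simp add: matrix_vector_mult_diff_distrib power2_eq_square algebra_simps)
qed

text \<open>Restrict \<open>f\<close> to the segment and subtract its quadratic Taylor polynomial.
  The scalar mean value theorem turns the remainder into a gradient remainder at an intermediate
  point, which \<open>gradient_taylor\<close> controls.\<close>

lemma taylor_upper:
  "f y \<le> f x + gradient f x \<bullet> (y - x) + (hessian f x *v (y - x)) \<bullet> (y - x) / 2 + K * norm (y - x) ^ 3"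
proof -
  let ?d = "y - x"
  let ?\<phi> = "\<lambda>s. f (x + s *\<^sub>R ?d) - s * (gradient f x \<bullet> ?d) - s\<^sup>2 * ((hessian f x *v ?d) \<bullet> ?d) / 2"
  let ?\<phi>' = "\<lambda>s. (gradient f (x + s *\<^sub>R ?d) - gradient f x - hessian f x *v (s *\<^sub>R ?d)) \<bullet> ?d"
  have "((\<lambda>s. f (x + s *\<^sub>R ?d)) has_derivative (\<lambda>h. (h *\<^sub>R ?d) \<bullet> gradient f (x + s *\<^sub>R ?d))) (at s)"
    for s
    by (rule has_derivative_compose[OF _ has_derivative_inner_gradient[OF C2]])
       (auto intro!: derivative_eq_intros)
  then have "((\<lambda>s. f (x + s *\<^sub>R ?d)) has_real_derivative gradient f (x + s *\<^sub>R ?d) \<bullet> ?d) (at s)" for s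
    unfolding has_field_derivative_def
    by (rule has_derivative_eq_rhs) (simp add: fun_eq_iff inner_commute)
  then have "DERIV ?\<phi> s :> ?\<phi>' s" for s
    by (auto intro!: derivative_eq_intros
        simp: inner_diff_left matrix_vector_mult_scaleR)
  then obtain s where s: "0 < s" "s < 1" "?\<phi> 1 - ?\<phi> 0 = ?\<phi>' s"
    using MVT2[of 0 1 ?\<phi> ?\<phi>'] by auto
  have "?\<phi>' s \<le> norm (gradient f (x + s *\<^sub>R ?d) - gradient f x - hessian f x *v (s *\<^sub>R ?d)) * norm ?d"
    by (rule norm_cauchy_schwarz)
  also have "\<dots> \<le> K * norm (s *\<^sub>R ?d) ^ 2 * norm ?d"
    using gradient_taylor[of "x + s *\<^sub>R ?d" x] by (intro mult_right_mono) auto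
  also have "\<dots> \<le> K * norm ?d ^ 2 * norm ?d"
    using s K_nonneg
    by (intro mult_right_mono mult_left_mono power_mono) (auto intro: mult_left_le_one_le)
  finally show ?thesis
    using s(3) by (simp add: power2_eq_square power3_eq_cube algebra_simps)
qed

end

section \<open>A single regularized step\<close>

lemma norm_simplex_combination_le:
  assumes "l \<in> std_simplex" and "\<And>j. norm (v j) \<le> B"
  shows "norm (\<Sum>j\<in>UNIV. l $ j *\<^sub>R v j) \<le> B"
proof -
  have "norm (\<Sum>j\<in>UNIV. l $ j *\<^sub>R v j) \<le> (\<Sum>j\<in>UNIV. l $ j * B)"
    by (rule sum_norm_le) (use assms in \<open>auto simp: std_simplex_def intro: mult_left_mono\<close>)
  also have "\<dots> = B"
    using assms(1) by (simp add: std_simplex_def flip: sum_distrib_right)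
  finally show ?thesis .
qed

text \<open>The multiplier stays fixed while the point moves. The Hessian bound \<open>h\<close> is
  assumed only at \<open>x\<close>; the term with \<open>K\<close> pays for the variation towards
  \<open>y\<close>.\<close>

lemma norm_weighted_grad_diff_le:
  assumes lip: "\<And>j. lipschitz_hessian (obj F j) K"
    and l: "l \<in> std_simplex"
    and h: "\<And>j. opnorm (hessian (obj F j) x) \<le> h"
  shows "norm (weighted_grad F l y - weighted_grad F l x) \<le> (h + K * norm (y - x)) * norm (y - x)"
proof -
  have "norm (gradient (obj F j) y - gradient (obj F j) x) \<le> (h + K * norm (y - x)) * norm (y - x)" for j
  proof -
    have "norm (gradient (obj F j) y - gradient (obj F j) x)
        \<le> norm (gradient (obj F j) y - gradient (obj F j) x - hessian (obj F j) x *v (y - x))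
          + norm (hessian (obj F j) x *v (y - x))"
      by norm
    also have "\<dots> \<le> K * norm (y - x) ^ 2 + h * norm (y - x)"
      by (intro add_mono lipschitz_hessian.gradient_taylor[OF lip]
          order_trans[OF norm_matrix_vector_le] mult_right_mono h) auto
    finally show ?thesis
      by (simp add: algebra_simps power2_eq_square)
  qed
  then show ?thesis
    using norm_simplex_combination_le[OF l,
        where v = "\<lambda>j. gradient (obj F j) y - gradient (obj F j) x"]
    by (simp add: weighted_grad_def scaleR_diff_right sum_subtractf)
qed

text \<open>One inner iteration in isolation, with exact gradients and Hessian error at most
  \<open>e\<close>. The acceptance test is not assumed, so that rejected and accepted trials are
  both covered.\<close>

locale accurate_step =
  fixes F :: "real^'n \<Rightarrow> real^'m" and K \<theta> s e :: real and xt y :: "real^'n" and l :: "real^'m"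
    and G :: "'m \<Rightarrow> real^'n" and H :: "'m \<Rightarrow> real^'n^'n"
  assumes lip: "\<And>j. lipschitz_hessian (obj F j) K"
    and step: "step_1_2 \<theta> s xt G H y l"
    and sym: "\<And>j. transpose (H j) = H j"
    and grad: "\<And>j. G j = gradient (obj F j) xt"
    and hess: "\<And>j. opnorm (hessian (obj F j) xt - H j) \<le> e"
    and s_nonneg: "0 \<le> s"
begin

lemma simplex: "l \<in> std_simplex"
  using step by (simp add: step_1_2_def)

text \<open>Step 1.2 makes the weighted sum of the model gradients small, so any vectors close to
  these have a small weighted sum too. It serves for the true gradients at \<open>y\<close> and at
  \<open>xt\<close>.\<close>

lemma norm_le_add_residual:
  assumes "\<And>j. norm (v j - gradient (model (G j) (H j) xt s) y) \<le> B"
  shows "norm (\<Sum>j\<in>UNIV. l $ j *\<^sub>R v j) \<le> B + \<theta> * norm (y - xt) ^ 2"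
proof -
  let ?r = "\<Sum>j\<in>UNIV. l $ j *\<^sub>R gradient (model (G j) (H j) xt s) y"
  have "norm (\<Sum>j\<in>UNIV. l $ j *\<^sub>R v j) \<le> norm ((\<Sum>j\<in>UNIV. l $ j *\<^sub>R v j) - ?r) + norm ?r"
    by norm
  also have "norm ((\<Sum>j\<in>UNIV. l $ j *\<^sub>R v j) - ?r) \<le> B"
    using norm_simplex_combination_le[OF simplex assms]
    by (simp add: scaleR_diff_right sum_subtractf)
  also have "norm ?r \<le> \<theta> * norm (y - xt) ^ 2"
    using step by (simp add: step_1_2_def)
  finally show ?thesis by simp
qed

lemma norm_hessian_error_le: "norm ((hessian (obj F j) xt - H j) *v v) \<le> e * norm v"
  by (rule order_trans[OF norm_matrix_vector_le mult_right_mono[OF hess]]) simp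

text \<open>True and model gradient at \<open>y\<close> differ by a Taylor remainder, the Hessian
  error and the gradient of the cubic term.\<close>

lemma norm_new_weighted_grad_le:
  "norm (weighted_grad F l y) \<le> (K + s / 2 + \<theta>) * norm (y - xt) ^ 2 + e * norm (y - xt)"
proof -
  let ?d = "y - xt"
  have "norm (gradient (obj F j) y - gradient (model (G j) (H j) xt s) y)
      \<le> K * norm ?d ^ 2 + e * norm ?d + s / 2 * norm ?d ^ 2" for j
  proof -
    have "gradient (obj F j) y - gradient (model (G j) (H j) xt s) y
        = (gradient (obj F j) y - gradient (obj F j) xt - hessian (obj F j) xt *v ?d)
          + (hessian (obj F j) xt - H j) *v ?d - (s / 2 * norm ?d) *\<^sub>R ?d"
      by (simp add: gradient_model sym grad matrix_vector_mult_diff_rdistrib)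
    also have "norm \<dots> \<le> K * norm ?d ^ 2 + e * norm ?d + norm ((s / 2 * norm ?d) *\<^sub>R ?d)"
      by (intro order_trans[OF norm_triangle_ineq4] order_trans[OF norm_triangle_ineq] add_mono
          lipschitz_hessian.gradient_taylor[OF lip] norm_hessian_error_le order_refl)
    finally show ?thesis
      using s_nonneg by (simp add: power2_eq_square)
  qed
  from norm_le_add_residual[OF this] show ?thesis
    by (simp add: weighted_grad_def algebra_simps)
qed

text \<open>The new multiplier is tested at the old point. As gradients are exact, the model
  gradient at \<open>y\<close> departs from the true one at \<open>xt\<close> only through the
  approximate Hessian and the cubic term, so the bound is linear in the step for bounded
  factors.\<close>

lemma norm_old_weighted_grad_le:
  assumes h: "\<And>j. opnorm (hessian (obj F j) xt) \<le> h"
  shows "norm (weighted_grad F l xt) \<le> (h + e + (s / 2 + \<theta>) * norm (y - xt)) * norm (y - xt)"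
proof -
  let ?d = "y - xt"
  have "norm (gradient (obj F j) xt - gradient (model (G j) (H j) xt s) y)
      \<le> e * norm ?d + h * norm ?d + s / 2 * norm ?d ^ 2" for j
  proof -
    have "gradient (obj F j) xt - gradient (model (G j) (H j) xt s) y
        = (hessian (obj F j) xt - H j) *v ?d - hessian (obj F j) xt *v ?d - (s / 2 * norm ?d) *\<^sub>R ?d"
      by (simp add: gradient_model sym grad matrix_vector_mult_diff_rdistrib)
    also have "norm \<dots> \<le> e * norm ?d + h * norm ?d + norm ((s / 2 * norm ?d) *\<^sub>R ?d)"
      by (intro order_trans[OF norm_triangle_ineq4] add_mono norm_hessian_error_le order_refl
          order_trans[OF norm_matrix_vector_le] mult_right_mono h norm_ge_zero)
    finally show ?thesis
      using s_nonneg by (simp add: power2_eq_square)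
  qed
  from norm_le_add_residual[OF this] show ?thesis
    by (simp add: weighted_grad_def algebra_simps power2_eq_square)
qed

text \<open>Subtract the nonpositive model value from the Taylor bound: the linear terms cancel, the
  quadratic ones leave the Hessian error, and the cubic ones leave \<open>K - s / 6\<close>.\<close>

lemma obj_upper:
  "obj F j y \<le> obj F j xt - (s / 6 - K) * norm (y - xt) ^ 3 + e / 2 * norm (y - xt) ^ 2"
proof -
  let ?d = "y - xt"
  have "model (G j) (H j) xt s y \<le> max_model G H xt s y"
    unfolding max_model_def by (rule Max_ge) auto
  also have "\<dots> \<le> 0"
    using step by (simp add: step_1_2_def)
  finally have m: "gradient (obj F j) xt \<bullet> ?d + (H j *v ?d) \<bullet> ?d / 2 + s / 6 * norm ?d ^ 3 \<le> 0"
    by (simp add: model_def grad)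
  have "((hessian (obj F j) xt - H j) *v ?d) \<bullet> ?d \<le> norm ((hessian (obj F j) xt - H j) *v ?d) * norm ?d"
    by (rule norm_cauchy_schwarz)
  also have "\<dots> \<le> e * norm ?d * norm ?d"
    by (intro mult_right_mono norm_hessian_error_le) auto
  finally have "(hessian (obj F j) xt *v ?d) \<bullet> ?d - (H j *v ?d) \<bullet> ?d \<le> e * norm ?d ^ 2"
    by (simp add: matrix_vector_mult_diff_rdistrib inner_diff_left power2_eq_square)
  with m lipschitz_hessian.taylor_upper[OF lip, of j y xt] show ?thesis
    by (simp add: left_diff_distrib)
qed

text \<open>Used in contrapositive form: a rejected trial has small regularization. Half of the
  decrease \<open>s / 6\<close> is what Step 1.3 asks for; the other half, with the slack
  \<open>st / 12\<close>, absorbs the Taylor and Hessian errors.\<close>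

lemma step_1_3_if_large:
  assumes s: "s = \<alpha> ^ i * st" and e: "e = e' * norm (xt - xprev)" and "0 \<le> e'"
    and s_large: "12 * K + 6 * e' \<le> s" and st_large: "6 * e' \<le> st"
  shows "step_1_3 F \<alpha> st i xprev xt y"
proof -
  define d where "d = norm (y - xt)"
  define \<delta> where "\<delta> = norm (xt - xprev)"
  have pos: "0 \<le> d" "0 \<le> \<delta>" by (auto simp: d_def \<delta>_def)
  \<comment> \<open>The mixed error term is at most the cube of the larger of the two step
    lengths.\<close>
  have "\<delta> * d ^ 2 \<le> d ^ 3 + \<delta> ^ 3"
  proof (cases "\<delta> \<le> d")
    case True
    then have "\<delta> * d ^ 2 \<le> d * d ^ 2"
      by (intro mult_right_mono) auto
    moreover have "0 \<le> \<delta> ^ 3"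
      using pos by simp
    ultimately show ?thesis
      by (simp add: power2_eq_square power3_eq_cube)
  next
    case False
    then have "\<delta> * d ^ 2 \<le> \<delta> * \<delta> ^ 2"
      using pos by (intro mult_left_mono power_mono) auto
    moreover have "0 \<le> d ^ 3"
      using pos by simp
    ultimately show ?thesis
      by (simp add: power2_eq_square power3_eq_cube)
  qed
  then have "e' * (\<delta> * d ^ 2) \<le> e' * d ^ 3 + e' * \<delta> ^ 3"
    using mult_left_mono[OF _ \<open>0 \<le> e'\<close>] by (simp flip: distrib_left)
  moreover have "e' * d ^ 3 \<le> (s / 6 - 2 * K) * d ^ 3"
    using s_large pos by (intro mult_right_mono) auto
  moreover have "e' * \<delta> ^ 3 \<le> st / 6 * \<delta> ^ 3"
    by (rule mult_right_mono) (use st_large pos in simp_all)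
  ultimately have main: "e' * \<delta> / 2 * d ^ 2 \<le> (s / 12 - K) * d ^ 3 + st / 12 * \<delta> ^ 3"
    by (simp add: algebra_simps)
  have ub: "obj F j y \<le> obj F j xt - (s / 6 - K) * d ^ 3 + e' * \<delta> / 2 * d ^ 2" for j
    using obj_upper[of j] by (simp add: d_def \<delta>_def e)
  have "s / 12 * d ^ 3 - st / 12 * \<delta> ^ 3 \<le> obj F j xt - obj F j y" for j
  proof -
    have "(s / 6 - K) * d ^ 3 = s / 12 * d ^ 3 + (s / 12 - K) * d ^ 3"
      by (simp add: algebra_simps)
    with ub[of j] main show ?thesis by linarith
  qed
  then show ?thesis
    by (simp add: step_1_3_def d_def \<delta>_def s)
qed

end

section \<open>Real sequences\<close>

text \<open>Halving gives \<open>a t \<le> 2 * (a t - a (Suc t))\<close>, so the step lengths are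
  dominated by a telescoping sum, and the bound passes to the limit.\<close>

lemma tail_le_of_halving:
  fixes x :: "nat \<Rightarrow> 'a::real_normed_vector" and a :: "nat \<Rightarrow> real"
  assumes lim: "x \<longlonglongrightarrow> l" and "0 \<le> c"
    and a_nonneg: "\<And>t. 0 \<le> a t"
    and step: "\<And>t. t \<ge> T \<Longrightarrow> norm (x (Suc t) - x t) \<le> c * a t"
    and half: "\<And>t. t \<ge> T \<Longrightarrow> a (Suc t) \<le> a t / 2"
    and "t \<ge> T"
  shows "norm (x t - l) \<le> 2 * c * a t"
proof -
  have tele: "norm (x t - x (t + n)) \<le> 2 * c * (a t - a (t + n))" for n
  proof (induction n)
    case (Suc n)
    have "norm (x (Suc (t + n)) - x (t + n)) \<le> c * a (t + n)"
      using step[of "t + n"] \<open>t \<ge> T\<close> by simp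
    also have "\<dots> \<le> c * (2 * (a (t + n) - a (Suc (t + n))))"
      using half[of "t + n"] \<open>t \<ge> T\<close> \<open>0 \<le> c\<close> by (intro mult_left_mono) auto
    finally have "norm (x (Suc (t + n)) - x (t + n)) \<le> 2 * c * (a (t + n) - a (Suc (t + n)))"
      by (simp only: mult.assoc mult.left_commute)
    moreover have "norm (x t - x (t + Suc n)) \<le> norm (x t - x (t + n)) + norm (x (Suc (t + n)) - x (t + n))"
      by simp norm
    ultimately show ?case
      using Suc.IH by (simp add: algebra_simps)
  qed simp
  have "norm (x t - x (t + n)) \<le> 2 * c * a t" for n
    using tele[of n] mult_nonneg_nonneg[OF \<open>0 \<le> c\<close> a_nonneg[of "t + n"]] by (simp add: algebra_simps)
  moreover have "(\<lambda>n. norm (x t - x (t + n))) \<longlonglongrightarrow> norm (x t - l)"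
    using LIMSEQ_ignore_initial_segment[OF lim, of t] by (intro tendsto_intros) (simp add: add.commute)
  ultimately show ?thesis
    by (intro LIMSEQ_le_const2) auto
qed

text \<open>Finitely many early ratios \<open>a t / b t\<close> can be added to the constant. Where
  \<open>b t\<close> vanishes no constant helps, and \<open>zero\<close> takes over.\<close>

lemma uniform_constant_of_eventually:
  fixes a b :: "nat \<Rightarrow> real"
  assumes ev: "\<forall>\<^sub>F t in sequentially. a t \<le> c * b t"
    and zero: "\<And>t. t \<ge> t1 \<Longrightarrow> b t = 0 \<Longrightarrow> a t = 0"
    and b_nonneg: "\<And>t. 0 \<le> b t"
  shows "\<exists>C>0. \<forall>t\<ge>t1. a t \<le> C * b t"
proof -
  obtain T where T: "\<And>t. t \<ge> T \<Longrightarrow> a t \<le> c * b t"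
    using ev by (auto simp: eventually_sequentially)
  define C where "C = 1 + \<bar>c\<bar> + (\<Sum>t<T. \<bar>a t / b t\<bar>)"
  have "C > 0"
    unfolding C_def by (simp add: add_pos_nonneg sum_nonneg)
  moreover have "a t \<le> C * b t" if "t \<ge> t1" for t
  proof (cases "t < T")
    case False
    have "c \<le> C"
      unfolding C_def using sum_nonneg[of "{..<T}" "\<lambda>t. \<bar>a t / b t\<bar>"] by simp
    then show ?thesis
      using T[of t] False mult_right_mono[OF _ b_nonneg[of t], of c C] by simp
  next
    case True
    then have "\<bar>a t / b t\<bar> \<le> (\<Sum>t<T. \<bar>a t / b t\<bar>)"
      by (intro member_le_sum) auto
    then have "a t / b t \<le> C"
      unfolding C_def by linarith
    then show ?thesis
      using zero[OF that] b_nonneg[of t] by (cases "b t = 0") (auto simp: field_simps)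
  qed
  ultimately show ?thesis by blast
qed

section \<open>Boundedness of the regularization parameters\<close>

text \<open>The run under (A1) and (A4) with one Lipschitz constant \<open>K\<close> for all
  objectives. The accuracy conditions cover rejected inner iterations, because the bound on
  \<open>\<sigma>\<close> inspects one of them.\<close>

locale exact_gradient_run =
  fixes F :: "real^'n \<Rightarrow> real^'m"
    and \<theta> \<alpha> \<kappa>G \<kappa>H \<zeta> K :: real
    and x :: "nat \<Rightarrow> real^'n" and \<sigma> :: "nat \<Rightarrow> real" and lam :: "nat \<Rightarrow> real^'m"
    and it :: "nat \<Rightarrow> nat"
    and gb :: "nat \<Rightarrow> nat \<Rightarrow> 'm \<Rightarrow> real^'n" and Hb :: "nat \<Rightarrow> nat \<Rightarrow> 'm \<Rightarrow> real^'n^'n"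
    and xp :: "nat \<Rightarrow> nat \<Rightarrow> real^'n" and lp :: "nat \<Rightarrow> nat \<Rightarrow> real^'m"
  assumes lip: "\<And>j. lipschitz_hessian (obj F j) K"
    and alg: "M_CRM F \<theta> \<alpha> \<kappa>G \<kappa>H x \<sigma> lam it gb Hb xp lp"
    and exact_grad: "\<And>t i j. t \<ge> 1 \<Longrightarrow> i \<in> inner_iters \<alpha> \<sigma> it t
          \<Longrightarrow> gb t i j = gradient (obj F j) (x t)"
    and hess_error: "\<And>t i j. t \<ge> 1 \<Longrightarrow> i \<in> inner_iters \<alpha> \<sigma> it t
          \<Longrightarrow> opnorm (hessian (obj F j) (x t) - Hb t i j)
            \<le> \<kappa>H / \<alpha> powi (int i - 1)
              * min (norm (x t - x (t - 1))) (\<zeta> * norm (weighted_grad F (lam t) (x t)))"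
    and zeta_nonneg: "0 \<le> \<zeta>"
begin

lemma params: "0 < \<sigma> 1" "0 \<le> \<theta>" "1 < \<alpha>" "0 \<le> \<kappa>H"
  using alg unfolding M_CRM_def by blast+

lemma K_nonneg: "0 \<le> K"
  using lipschitz_hessian.K_nonneg[OF lip] .

lemma outer:
  assumes "t \<ge> 1"
  shows "first_inner \<alpha> \<sigma> t \<le> it t"
    and "x (Suc t) = xp t (it t)" and "lam (Suc t) = lp t (it t)"
    and "\<sigma> (Suc t) = \<alpha> powi (int (it t) - 1) * \<sigma> t"
  using alg assms unfolding M_CRM_def Suc_eq_plus1 by blast+

lemma inner:
  assumes "t \<ge> 1" and "i \<in> inner_iters \<alpha> \<sigma> it t"
  shows "transpose (Hb t i j) = Hb t i j"
    and "step_1_2 \<theta> (\<alpha> ^ i * \<sigma> t) (x t) (gb t i) (Hb t i) (xp t i) (lp t i)"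
    and "step_1_3 F \<alpha> (\<sigma> t) i (x (t - 1)) (x t) (xp t i) \<longleftrightarrow> i = it t"
  using alg assms unfolding M_CRM_def step_1_1_def by blast+

lemma sigma_ge: "t \<ge> 1 \<Longrightarrow> \<sigma> 1 \<le> \<sigma> t"
proof (induction t rule: dec_induct)
  case (step t)
  have "\<sigma> 1 \<le> \<alpha> powi (int (first_inner \<alpha> \<sigma> t) - 1) * \<sigma> t"
    \<comment> \<open>Index 1 has exponent 0, so the induction hypothesis makes it an admissible
      witness.\<close>
    unfolding first_inner_def by (rule LeastI[of _ 1]) (use step in simp)
  also have "\<dots> \<le> \<alpha> powi (int (it t) - 1) * \<sigma> t"
    using outer(1)[of t] step params by (intro mult_right_mono power_int_increasing) auto
  finally show ?case
    using outer(4)[of t] step by simp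
qed simp

lemma sigma_pos: "t \<ge> 1 \<Longrightarrow> 0 < \<sigma> t"
  using sigma_ge[of t] params by linarith

text \<open>So an accepted index above 1, the only kind that increases \<open>\<sigma>\<close>, is preceded by a failed
  inner iteration.\<close>
lemma first_inner_le_1: "t \<ge> 1 \<Longrightarrow> first_inner \<alpha> \<sigma> t \<le> 1"
  unfolding first_inner_def using sigma_ge by (intro Least_le) simp

text \<open>The worst case is \<open>i = 0\<close>, where the exponent is -1.\<close>

lemma error_factor_le: "\<kappa>H / \<alpha> powi (int i - 1) \<le> \<alpha> * \<kappa>H"
proof -
  have "\<alpha> powi (-1) \<le> \<alpha> powi (int i - 1)"
    using params by (intro power_int_increasing) auto
  then have "1 \<le> \<alpha> * \<alpha> powi (int i - 1)"
    using params by (simp add: power_int_minus field_simps)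
  then have "\<kappa>H * 1 \<le> \<kappa>H * (\<alpha> * \<alpha> powi (int i - 1))"
    using params by (intro mult_left_mono) auto
  then show ?thesis
    using params by (simp add: divide_le_eq mult_ac)
qed

text \<open>The error level \<open>e\<close> is left free: a multiple of the last step length bounds
  \<open>\<sigma>\<close>, while the full minimum of (A4) gives the rates.\<close>

lemma accurate_step:
  assumes "t \<ge> 1" and "i \<in> inner_iters \<alpha> \<sigma> it t"
    and "\<And>j. opnorm (hessian (obj F j) (x t) - Hb t i j) \<le> e"
  shows "accurate_step F K \<theta> (\<alpha> ^ i * \<sigma> t) e (x t) (xp t i) (lp t i) (gb t i) (Hb t i)"
  using assms inner[OF assms(1,2)] exact_grad[OF assms(1,2)] lip sigma_pos[of t] params
  by unfold_locales (auto simp: lipschitz_hessian_def)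

text \<open>An accepted index at most 1 does not increase \<open>\<sigma>\<close>. Otherwise the
  preceding trial was rejected, and its regularization parameter is exactly
  \<open>\<sigma> (Suc t)\<close>, so \<open>step_1_3_if_large\<close> limits it.\<close>

lemma sigma_Suc_le:
  assumes "t \<ge> 1"
  shows "\<sigma> (Suc t) \<le> max (\<sigma> t) (12 * K + 6 * \<alpha> * \<kappa>H)"
proof (cases "it t \<le> 1")
  case True
  then have "it t = 0 \<or> it t = 1" by linarith
  then have "\<sigma> (Suc t) \<le> \<sigma> t"
    using outer(4)[OF assms] sigma_pos[OF assms] params
    by (auto simp: power_int_minus divide_le_eq field_simps)
  then show ?thesis by simp
next
  case False
  then obtain i where i: "it t = Suc i" "1 \<le> i"
    by (cases "it t") auto
  then have inn: "i \<in> inner_iters \<alpha> \<sigma> it t"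
    using first_inner_le_1[OF assms] by (simp add: inner_iters_def)
  define e' where "e' = \<kappa>H / \<alpha> powi (int i - 1)"
  have e': "0 \<le> e'" "e' \<le> \<alpha> * \<kappa>H"
    using error_factor_le params by (auto simp: e'_def)
  interpret accurate_step F K \<theta> "\<alpha> ^ i * \<sigma> t" "e' * norm (x t - x (t - 1))"
      "x t" "xp t i" "lp t i" "gb t i" "Hb t i"
  proof (rule accurate_step[OF assms inn])
    show "opnorm (hessian (obj F j) (x t) - Hb t i j) \<le> e' * norm (x t - x (t - 1))" for j
      using hess_error[OF assms inn, of j] mult_left_mono[OF min.cobounded1 e'(1)]
      unfolding e'_def by (rule order_trans)
  qed
  have s: "\<sigma> (Suc t) = \<alpha> ^ i * \<sigma> t"
    using outer(4)[OF assms] i by simp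
  \<comment> \<open>This form exposes the denominator of \<open>e'\<close>, so the condition
    \<open>6 * e' \<le> \<sigma> t\<close> becomes a threshold on \<open>\<sigma> (Suc t)\<close>
    free of \<open>i\<close>.\<close>
  have s': "\<sigma> (Suc t) = \<alpha> * \<alpha> powi (int i - 1) * \<sigma> t"
    using s params by (simp add: power_int_diff)
  have "\<not> step_1_3 F \<alpha> (\<sigma> t) i (x (t - 1)) (x t) (xp t i)"
    using inner(3)[OF assms inn] i by simp
  then have "\<not> (12 * K + 6 * e' \<le> \<alpha> ^ i * \<sigma> t \<and> 6 * e' \<le> \<sigma> t)"
    using step_1_3_if_large[OF refl refl e'(1)] by blast
  moreover have "6 * e' \<le> \<sigma> t" if "6 * \<alpha> * \<kappa>H \<le> \<sigma> (Suc t)"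
    using that params unfolding s' e'_def by (simp add: divide_le_eq mult_ac)
  ultimately have "\<sigma> (Suc t) < 12 * K + 6 * e' \<or> \<sigma> (Suc t) < 6 * (\<alpha> * \<kappa>H)"
    using s by (auto simp: not_le mult.assoc)
  then have "\<sigma> (Suc t) \<le> 12 * K + 6 * (\<alpha> * \<kappa>H)"
    using e' K_nonneg by linarith
  then show ?thesis by (simp add: mult.assoc)
qed

lemma sigma_le: "t \<ge> 1 \<Longrightarrow> \<sigma> t \<le> max (\<sigma> 1) (12 * K + 6 * \<alpha> * \<kappa>H)"
proof (induction t rule: dec_induct)
  case (step t)
  then show ?case
    using sigma_Suc_le[of t] by simp
qed simp

section \<open>Gradient bounds at accepted steps\<close>

lemma lam_simplex: "t \<ge> 1 \<Longrightarrow> lam t \<in> std_simplex"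
proof (induction t rule: dec_induct)
  case base
  show ?case using alg unfolding M_CRM_def by blast
next
  case (step t)
  then have "it t \<in> inner_iters \<alpha> \<sigma> it t"
    using outer(1)[of t] by (simp add: inner_iters_def)
  then show ?case
    using inner(2)[of t "it t"] outer(3)[of t] step by (simp add: step_1_2_def)
qed

text \<open>The coefficient \<open>K + s / 2 + \<theta>\<close> of a single step, with
  \<open>s\<close> replaced by its uniform bound along the run.\<close>

definition step_const :: real where
  "step_const = K + \<alpha> * max (\<sigma> 1) (12 * K + 6 * \<alpha> * \<kappa>H) / 2 + \<theta>"

lemma step_const_pos: "0 < step_const"
  unfolding step_const_def using params K_nonneg
  by (intro add_nonneg_pos add_pos_nonneg divide_pos_pos mult_pos_pos) auto

lemma outer_step_bounds:
  assumes "t \<ge> 1"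
  defines "e \<equiv> \<alpha> * \<kappa>H
      * min (norm (x t - x (t - 1))) (\<zeta> * norm (weighted_grad F (lam t) (x t)))"
  shows "norm (weighted_grad F (lam (Suc t)) (x (Suc t)))
      \<le> step_const * norm (x (Suc t) - x t) ^ 2 + e * norm (x (Suc t) - x t)"
    and "(\<And>j. opnorm (hessian (obj F j) (x t)) \<le> h) \<Longrightarrow>
      norm (weighted_grad F (lam (Suc t)) (x t))
      \<le> (h + e + step_const * norm (x (Suc t) - x t)) * norm (x (Suc t) - x t)"
proof -
  let ?i = "it t"
  have inn: "?i \<in> inner_iters \<alpha> \<sigma> it t"
    using outer(1)[of t] assms by (simp add: inner_iters_def)
  interpret accurate_step F K \<theta> "\<alpha> ^ ?i * \<sigma> t" e "x t" "x (Suc t)" "lam (Suc t)" "gb t ?i" "Hb t ?i"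
    unfolding outer(2,3)[OF assms(1)]
  proof (rule accurate_step[OF assms(1) inn])
    show "opnorm (hessian (obj F j) (x t) - Hb t ?i j) \<le> e" for j
      using hess_error[OF assms(1) inn, of j] unfolding e_def
      by (rule order_trans)
         (use zeta_nonneg in \<open>intro mult_right_mono error_factor_le, simp\<close>)
  qed
  \<comment> \<open>The accepted trial used one factor \<open>\<alpha>\<close> more than the value
    stored for the next iteration.\<close>
  have "\<alpha> ^ ?i * \<sigma> t = \<alpha> * \<sigma> (Suc t)"
    using outer(4)[OF assms(1)] params by (simp add: power_int_diff)
  also have "\<dots> \<le> \<alpha> * max (\<sigma> 1) (12 * K + 6 * \<alpha> * \<kappa>H)"
    using sigma_le[of "Suc t"] params by (intro mult_left_mono) auto
  finally have s: "K + \<alpha> ^ ?i * \<sigma> t / 2 + \<theta> \<le> step_const"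
    by (simp add: step_const_def)
  show "norm (weighted_grad F (lam (Suc t)) (x (Suc t)))
      \<le> step_const * norm (x (Suc t) - x t) ^ 2 + e * norm (x (Suc t) - x t)"
    using norm_new_weighted_grad_le mult_right_mono[OF s, of "norm (x (Suc t) - x t) ^ 2"]
    by simp
  assume h: "\<And>j. opnorm (hessian (obj F j) (x t)) \<le> h"
  have "(h + e + (\<alpha> ^ ?i * \<sigma> t / 2 + \<theta>) * norm (x (Suc t) - x t)) * norm (x (Suc t) - x t)
      \<le> (h + e + step_const * norm (x (Suc t) - x t)) * norm (x (Suc t) - x t)"
    using s K_nonneg by (intro mult_right_mono add_left_mono) auto
  with norm_old_weighted_grad_le[OF h] show "norm (weighted_grad F (lam (Suc t)) (x t))
      \<le> (h + e + step_const * norm (x (Suc t) - x t)) * norm (x (Suc t) - x t)"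
    by linarith
qed

end

section \<open>Convergence rates\<close>

text \<open>The step bound holds for every simplex multiplier, a freedom that
  \<open>step_le_distance\<close> exploits.\<close>

locale convergent_run = exact_gradient_run +
  fixes \<mu> :: real and xstar and t1 :: nat
  assumes mu_pos: "0 < \<mu>" and lim: "x \<longlonglongrightarrow> xstar" and t1: "1 \<le> t1"
    and step_le: "\<And>t l. t \<ge> t1 \<Longrightarrow> l \<in> std_simplex
          \<Longrightarrow> norm (x (Suc t) - x t) \<le> 4 / \<mu> * norm (weighted_grad F l (x t))"
begin

abbreviation g where "g t \<equiv> weighted_grad F (lam t) (x t)"

lemma step_tendsto_0: "(\<lambda>t. norm (x (Suc t) - x t)) \<longlonglongrightarrow> 0"
  using tendsto_norm[OF tendsto_diff[OF LIMSEQ_Suc[OF lim] lim]] by simp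

text \<open>Of the minimum in the Hessian error the step length is kept, since it is already known
  to vanish. The bound is then built from products of vanishing step lengths.\<close>

lemma g_tendsto_0: "(\<lambda>t. norm (g t)) \<longlonglongrightarrow> 0"
proof -
  let ?D = "\<lambda>t. norm (x (Suc t) - x t)"
  have le: "norm (g (Suc (Suc t))) \<le> step_const * ?D (Suc t) ^ 2 + \<alpha> * \<kappa>H * ?D t * ?D (Suc t)" for t
  proof -
    let ?m = "min (?D t) (\<zeta> * norm (g (Suc t)))"
    have "norm (g (Suc (Suc t))) \<le> step_const * ?D (Suc t) ^ 2 + \<alpha> * \<kappa>H * ?m * ?D (Suc t)"
      using outer_step_bounds(1)[of "Suc t"] by simp
    moreover have "\<alpha> * \<kappa>H * ?m * ?D (Suc t) \<le> \<alpha> * \<kappa>H * ?D t * ?D (Suc t)"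
      using params by (intro mult_right_mono mult_left_mono) auto
    ultimately show ?thesis by linarith
  qed
  have lim0: "(\<lambda>t. step_const * ?D (Suc t) ^ 2 + \<alpha> * \<kappa>H * ?D t * ?D (Suc t)) \<longlonglongrightarrow> 0"
  proof -
    have "(\<lambda>t. step_const * ?D (Suc t) ^ 2 + \<alpha> * \<kappa>H * ?D t * ?D (Suc t))
        \<longlonglongrightarrow> step_const * 0 ^ 2 + \<alpha> * \<kappa>H * 0 * 0"
      by (intro tendsto_add tendsto_mult tendsto_power tendsto_const step_tendsto_0
          LIMSEQ_Suc[OF step_tendsto_0])
    then show ?thesis by (rule tendsto_eq_rhs) simp
  qed
  have "(\<lambda>t. norm (g (Suc (Suc t)))) \<longlonglongrightarrow> 0"
    by (rule Lim_null_comparison[OF always_eventually[OF allI] lim0])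
       (simp only: real_norm_def abs_norm_cancel le)
  then show ?thesis
    using LIMSEQ_offset[of "\<lambda>t. norm (g t)" 2 0] by (simp add: numeral_2_eq_2)
qed

section \<open>Uniform bounds along the trajectory and the resulting rates\<close>

lemma bounded_iterates: "\<exists>R>0. \<forall>s t. norm (x t - x s) \<le> R"
proof -
  obtain B where B: "0 < B" "\<And>t. norm (x t) \<le> B"
    using convergent_imp_Bseq[OF convergentI[OF lim]] unfolding Bseq_def by blast
  have "norm (x t - x s) \<le> 2 * B" for s t
    using norm_triangle_ineq4[of "x t" "x s"] B(2)[of t] B(2)[of s] by linarith
  then show ?thesis
    using B(1) by (intro exI[of _ "2 * B"]) auto
qed

lemma bounded_hessians: "\<exists>h>0. \<forall>t j. opnorm (hessian (obj F j) (x t)) \<le> h"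
proof -
  obtain R where R: "R > 0" "\<And>s t. norm (x t - x s) \<le> R"
    using bounded_iterates by blast
  define h where "h = 1 + (\<Sum>j\<in>UNIV. opnorm (hessian (obj F j) (x 0))) + K * R"
  have "h > 0"
    unfolding h_def using K_nonneg R(1)
    by (intro add_pos_nonneg sum_nonneg mult_nonneg_nonneg) (auto simp: opnorm_nonneg)
  moreover have "opnorm (hessian (obj F j) (x t)) \<le> h" for t j
  proof -
    have "opnorm (hessian (obj F j) (x 0)) \<le> (\<Sum>j\<in>UNIV. opnorm (hessian (obj F j) (x 0)))"
      by (intro member_le_sum) (auto simp: opnorm_nonneg)
    moreover have "opnorm (hessian (obj F j) (x t) - hessian (obj F j) (x 0)) \<le> K * R"
      using lipschitz_hessian.lipschitz[OF lip, of j "x t" "x 0"]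
        mult_left_mono[OF R(2)[of t 0] K_nonneg] by linarith
    ultimately show ?thesis
      using opnorm_le_add_diff[of "hessian (obj F j) (x t)" "hessian (obj F j) (x 0)"]
      unfolding h_def by linarith
  qed
  ultimately show ?thesis by blast
qed

text \<open>Testing the step bound with the multipliers \<open>lam s\<close> and letting \<open>s\<close> tend to infinity
  replaces the choice of a limiting Pareto multiplier at \<open>xstar\<close>.\<close>
lemma step_le_distance:
  "\<exists>c>0. \<forall>t\<ge>t1. norm (x (Suc t) - x t) \<le> c * norm (x t - xstar)"
proof -
  obtain R where R: "R > 0" "\<And>s t. norm (x t - x s) \<le> R"
    using bounded_iterates by blast
  obtain h where h: "h > 0" "\<And>t j. opnorm (hessian (obj F j) (x t)) \<le> h"
    using bounded_hessians by blast
  define b where "b = h + K * R"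
  have b: "0 < b"
    unfolding b_def using h(1) R(1) K_nonneg by (simp add: add_pos_nonneg)
  have "norm (x (Suc t) - x t) \<le> 4 / \<mu> * b * norm (x t - xstar)" if "t \<ge> t1" for t
  proof -
    have le: "norm (x (Suc t) - x t) \<le> 4 / \<mu> * (norm (g s) + b * norm (x t - x s))" if "s \<ge> 1" for s
    proof -
      have "norm (weighted_grad F (lam s) (x t) - g s)
          \<le> (h + K * norm (x t - x s)) * norm (x t - x s)"
        by (rule norm_weighted_grad_diff_le[OF lip lam_simplex[OF that] h(2)])
      also have "\<dots> \<le> b * norm (x t - x s)"
        unfolding b_def using R(2) K_nonneg by (intro mult_right_mono add_left_mono mult_left_mono) auto
      finally have "norm (weighted_grad F (lam s) (x t)) \<le> norm (g s) + b * norm (x t - x s)"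
        using norm_triangle_sub[of "weighted_grad F (lam s) (x t)" "g s"] by linarith
      then show ?thesis
        using step_le[OF \<open>t \<ge> t1\<close> lam_simplex[OF that]] mu_pos
        by (elim order_trans) (intro mult_left_mono, auto)
    qed
    have "(\<lambda>s. 4 / \<mu> * (norm (g s) + b * norm (x t - x s)))
        \<longlonglongrightarrow> 4 / \<mu> * (0 + b * norm (x t - xstar))"
      by (intro tendsto_intros g_tendsto_0 lim)
    then show ?thesis
      using le by (intro LIMSEQ_le_const[where X = "\<lambda>s. 4 / \<mu> * (norm (g s) + b * norm (x t - x s))"])
        (auto simp: mult.assoc)
  qed
  then show ?thesis
    using b mu_pos by (intro exI[of _ "4 / \<mu> * b"]) auto
qed

text \<open>Now the other entry of the minimum is taken, and one of the two step factors is traded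
  for the gradient by the step bound. The remaining step factor drives both the halving of
  \<open>g\<close> and the final product rate.\<close>

lemma g_Suc_le:
  "\<exists>c>0. \<forall>t\<ge>t1. norm (g (Suc t)) \<le> c * norm (g t) * norm (x (Suc t) - x t)"
proof -
  let ?D = "\<lambda>t. norm (x (Suc t) - x t)"
  let ?c = "4 / \<mu> * step_const + \<alpha> * \<kappa>H * \<zeta>"
  have "norm (g (Suc t)) \<le> ?c * norm (g t) * ?D t" if "t \<ge> t1" for t
  proof -
    let ?m = "min (norm (x t - x (t - 1))) (\<zeta> * norm (g t))"
    have "norm (g (Suc t)) \<le> step_const * ?D t ^ 2 + \<alpha> * \<kappa>H * ?m * ?D t"
      using outer_step_bounds(1)[of t] that t1 by simp
    also have "step_const * ?D t ^ 2 \<le> step_const * (4 / \<mu> * norm (g t)) * ?D t"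
    proof -
      have "?D t \<le> 4 / \<mu> * norm (g t)"
        by (rule step_le[OF that lam_simplex]) (use that t1 in simp)
      then have "step_const * ?D t * ?D t \<le> step_const * (4 / \<mu> * norm (g t)) * ?D t"
        using step_const_pos by (intro mult_right_mono mult_left_mono) simp_all
      then show ?thesis
        by (simp add: power2_eq_square mult.assoc)
    qed
    also have "\<alpha> * \<kappa>H * ?m * ?D t \<le> \<alpha> * \<kappa>H * (\<zeta> * norm (g t)) * ?D t"
      using params by (intro mult_right_mono mult_left_mono) auto
    finally show ?thesis
      by (simp add: algebra_simps)
  qed
  moreover have "0 < ?c"
    using step_const_pos mu_pos params zeta_nonneg by (intro add_pos_nonneg) auto
  ultimately show ?thesis by blast
qed

lemma distance_le_g: "\<exists>c>0. \<forall>t\<ge>t1. norm (x t - xstar) \<le> c * norm (g t)"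
proof -
  let ?D = "\<lambda>t. norm (x (Suc t) - x t)"
  obtain c where c: "c > 0" "\<And>t. t \<ge> t1 \<Longrightarrow> norm (g (Suc t)) \<le> c * norm (g t) * ?D t"
    using g_Suc_le by blast
  have D: "?D t \<le> 4 / \<mu> * norm (g t)" if "t \<ge> t1" for t
    using step_le[OF that lam_simplex] that t1 by auto
  have mu: "0 \<le> 4 / \<mu>"
    using mu_pos by simp
  \<comment> \<open>Halving is a premise here because the bound is used twice: for late indices, and
    from an index where \<open>g\<close> vanishes.\<close>
  have tail: "norm (x t - xstar) \<le> 2 * (4 / \<mu>) * norm (g t)"
    if "t \<ge> t1" and "\<And>s. s \<ge> t \<Longrightarrow> norm (g (Suc s)) \<le> norm (g s) / 2" for t
    by (rule tail_le_of_halving[OF lim mu, where T = t and a = "\<lambda>t. norm (g t)"])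
      (use that D in auto)
  have "(\<lambda>t. c * ?D t) \<longlonglongrightarrow> 0"
    using tendsto_mult_right_zero[OF step_tendsto_0] .
  then have "\<forall>\<^sub>F t in sequentially. c * ?D t < 1 / 2"
    by (rule order_tendstoD) simp
  then obtain T where T: "\<And>t. t \<ge> T \<Longrightarrow> c * ?D t < 1 / 2"
    by (auto simp: eventually_sequentially)
  have half: "norm (g (Suc s)) \<le> norm (g s) / 2" if "s \<ge> T" "s \<ge> t1" for s
  proof -
    have "norm (g (Suc s)) \<le> (c * ?D s) * norm (g s)"
      using c(2)[OF that(2)] by (simp add: mult_ac)
    also have "\<dots> \<le> 1 / 2 * norm (g s)"
      using T[OF that(1)] by (intro mult_right_mono) auto
    finally show ?thesis by simp
  qed
  show ?thesis
  proof (rule uniform_constant_of_eventually)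
    show "\<forall>\<^sub>F t in sequentially. norm (x t - xstar) \<le> 2 * (4 / \<mu>) * norm (g t)"
      unfolding eventually_sequentially
      by (rule exI[of _ "max T t1"]) (use tail half in auto)
    fix t assume "t \<ge> t1" and "norm (g t) = 0"
    \<comment> \<open>By \<open>g_Suc_le\<close> a zero of \<open>g\<close> persists, so halving
      holds trivially from \<open>t\<close> on and \<open>tail\<close> gives distance 0.\<close>
    have "norm (g s) = 0" if "s \<ge> t" for s
      using that
    proof (induction s rule: dec_induct)
      case base
      show ?case by fact
    next
      case (step s)
      then show ?case
        using c(2)[of s] \<open>t \<ge> t1\<close> by simp
    qed
    then have "norm (g (Suc s)) \<le> norm (g s) / 2" if "s \<ge> t" for s
      using that by simp
    from tail[OF \<open>t \<ge> t1\<close> this] show "norm (x t - xstar) = 0"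
      using \<open>norm (g t) = 0\<close> by simp
  qed simp
qed

text \<open>The factor multiplying the step length stays bounded, since Hessians and distances
  between iterates are.\<close>

lemma old_weighted_grad_le:
  "\<exists>c>0. \<forall>t\<ge>t1. norm (weighted_grad F (lam (Suc t)) (x t)) \<le> c * norm (x (Suc t) - x t)"
proof -
  obtain R where R: "R > 0" "\<And>s t. norm (x t - x s) \<le> R"
    using bounded_iterates by blast
  obtain h where h: "h > 0" "\<And>t j. opnorm (hessian (obj F j) (x t)) \<le> h"
    using bounded_hessians by blast
  let ?c = "h + \<alpha> * \<kappa>H * R + step_const * R"
  have "norm (weighted_grad F (lam (Suc t)) (x t)) \<le> ?c * norm (x (Suc t) - x t)"
    if "t \<ge> t1" for t
  proof -
    let ?m = "min (norm (x t - x (t - 1))) (\<zeta> * norm (g t))"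
    have "norm (weighted_grad F (lam (Suc t)) (x t))
        \<le> (h + \<alpha> * \<kappa>H * ?m + step_const * norm (x (Suc t) - x t)) * norm (x (Suc t) - x t)"
      using that t1 h(2) by (intro outer_step_bounds(2)) auto
    also have "\<dots> \<le> ?c * norm (x (Suc t) - x t)"
      using params step_const_pos R(2)[of t "t - 1"] R(2)[of "Suc t" t]
      by (intro mult_right_mono add_mono mult_left_mono order_refl) (auto simp: min_le_iff_disj)
    finally show ?thesis .
  qed
  moreover have "?c > 0"
    using h(1) R(1) params step_const_pos by (intro add_pos_nonneg) auto
  ultimately show ?thesis by blast
qed

lemma rates:
  "\<exists>C1>0. \<exists>C2>0. \<exists>C3>0. \<forall>t\<ge>t1.
     norm (x (Suc t) - xstar) \<le> C1 * norm (g (Suc t)) \<and>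
     norm (weighted_grad F (lam (Suc t)) (x t))
       \<le> C2 * min (norm (x (Suc t) - x t)) (norm (x t - xstar)) \<and>
     norm (x (Suc t) - xstar) \<le> C3 * norm (g t) * norm (x t - xstar)"
proof -
  obtain a where a: "a > 0" "\<And>t. t \<ge> t1 \<Longrightarrow> norm (x (Suc t) - x t) \<le> a * norm (x t - xstar)"
    using step_le_distance by blast
  obtain b where b: "b > 0" "\<And>t. t \<ge> t1 \<Longrightarrow> norm (g (Suc t)) \<le> b * norm (g t) * norm (x (Suc t) - x t)"
    using g_Suc_le by blast
  obtain c where c: "c > 0" "\<And>t. t \<ge> t1 \<Longrightarrow> norm (x t - xstar) \<le> c * norm (g t)"
    using distance_le_g by blast
  obtain d where d: "d > 0" "\<And>t. t \<ge> t1 \<Longrightarrow>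
      norm (weighted_grad F (lam (Suc t)) (x t)) \<le> d * norm (x (Suc t) - x t)"
    using old_weighted_grad_le by blast
  show ?thesis
  proof (rule exI[of _ c], intro conjI, rule c, rule exI[of _ "d * (1 + a)"], intro conjI,
      use a d in simp, rule exI[of _ "c * (b * a)"], intro conjI, use a b c in simp, intro allI impI conjI)
    fix t assume t: "t \<ge> t1"
    show new: "norm (x (Suc t) - xstar) \<le> c * norm (g (Suc t))"
      using c(2)[of "Suc t"] t by simp
    \<comment> \<open>The constant \<open>1 + a\<close> dominates both 1 and \<open>a\<close>, so it
      serves whichever entry is the minimum.\<close>
    have "norm (x (Suc t) - x t) \<le> (1 + a) * min (norm (x (Suc t) - x t)) (norm (x t - xstar))"
    proof (cases "norm (x (Suc t) - x t) \<le> norm (x t - xstar)")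
      case True
      then show ?thesis
        using a(1) by (simp add: distrib_right)
    next
      case False
      then have "norm (x (Suc t) - x t) \<le> norm (x t - xstar) + a * norm (x t - xstar)"
        using a(2)[OF t] norm_ge_zero[of "x t - xstar"] by linarith
      with False show ?thesis
        by (simp add: distrib_right)
    qed
    then have "d * norm (x (Suc t) - x t)
        \<le> d * ((1 + a) * min (norm (x (Suc t) - x t)) (norm (x t - xstar)))"
      using d(1) by (intro mult_left_mono) auto
    then show "norm (weighted_grad F (lam (Suc t)) (x t))
        \<le> d * (1 + a) * min (norm (x (Suc t) - x t)) (norm (x t - xstar))"
      using d(2)[OF t] by (simp add: mult.assoc)
    \<comment> \<open>Third rate: the new distance is bounded by the new gradient, then by old
      gradient times step, then by old gradient times old distance.\<close>
    have "norm (g (Suc t)) \<le> b * norm (g t) * norm (x (Suc t) - x t)"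
      by (rule b(2)[OF t])
    also have "\<dots> \<le> b * norm (g t) * (a * norm (x t - xstar))"
      using a(2)[OF t] b(1) by (intro mult_left_mono) auto
    finally have "c * norm (g (Suc t)) \<le> c * (b * norm (g t) * (a * norm (x t - xstar)))"
      using c(1) by (intro mult_left_mono) auto
    with new show "norm (x (Suc t) - xstar) \<le> c * (b * a) * norm (g t) * norm (x t - xstar)"
      by (simp add: mult_ac)
  qed
qed

lemma superlinear: "superlinearly_convergent x xstar"
proof -
  obtain c where c: "\<And>t. t \<ge> t1 \<Longrightarrow> norm (x (Suc t) - xstar) \<le> c * norm (g t) * norm (x t - xstar)"
    using rates by blast
  have "(\<lambda>t. c * norm (g t)) \<longlonglongrightarrow> 0"
    using tendsto_mult_right_zero[OF g_tendsto_0] .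
  then show ?thesis
    unfolding superlinearly_convergent_def eventually_sequentially
    using c by (intro exI[of _ "\<lambda>t. c * norm (g t)"]) auto
qed

end

section \<open>Specialization to the given data\<close>

theorem theorem3p7:
  fixes F :: "real^'n \<Rightarrow> real^'m"
    and \<theta> \<alpha> \<kappa>G \<kappa>H L \<mu> \<zeta> \<sigma>max C :: real
    and Lj :: "'m \<Rightarrow> real"
    and x :: "nat \<Rightarrow> real^'n" and \<sigma> :: "nat \<Rightarrow> real" and lam :: "nat \<Rightarrow> real^'m"
    and it :: "nat \<Rightarrow> nat"
    and gb :: "nat \<Rightarrow> nat \<Rightarrow> 'm \<Rightarrow> real^'n" and Hb :: "nat \<Rightarrow> nat \<Rightarrow> 'm \<Rightarrow> real^'n^'n"
    and xp :: "nat \<Rightarrow> nat \<Rightarrow> real^'n" and lp :: "nat \<Rightarrow> nat \<Rightarrow> real^'m"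
    and g \<Delta>x :: "nat \<Rightarrow> real^'n"
    and xstar :: "real^'n" and t0 t1 :: nat
  assumes C2: "\<And>j. twice_cont_differentiable (obj F j)"
    and alg: "M_CRM F \<theta> \<alpha> \<kappa>G \<kappa>H x \<sigma> lam it gb Hb xp lp"
    and g: "\<And>t. t \<ge> 1 \<Longrightarrow> g t = weighted_grad F (lam t) (x t)"
    and \<Delta>x: "\<And>t. t \<ge> 1 \<Longrightarrow> \<Delta>x t = x t - x (t - 1)"
    and A1: "\<And>j y z. opnorm (hessian (obj F j) y - hessian (obj F j) z) \<le> Lj j * norm (y - z)"
    and L: "L = (MAX j. Lj j)"
    and A2: "\<And>j. \<exists>Fstar. \<forall>y. obj F j y \<ge> Fstar"
    and mu_pos: "\<mu> > 0"
    and A3: "\<And>j y. obj F j y \<le> obj F j (x t0) + \<sigma> 1 / 12 * norm (x 1 - x 0) ^ 3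
               \<Longrightarrow> loewner_le (\<mu> *\<^sub>R mat 1) (hessian (obj F j) y)"
    and zeta_pos: "\<zeta> > 0"
    and A4_grad: "\<And>t i j. t \<ge> 1 \<Longrightarrow> i \<in> inner_iters \<alpha> \<sigma> it t
               \<Longrightarrow> gb t i j = gradient (obj F j) (x t)"
    and A4_hess: "\<And>t i j. t \<ge> 1 \<Longrightarrow> i \<in> inner_iters \<alpha> \<sigma> it t
               \<Longrightarrow> opnorm (hessian (obj F j) (x t) - Hb t i j)
                     \<le> \<kappa>H / \<alpha> powi (int i - 1) * min (norm (\<Delta>x t)) (\<zeta> * norm (g t))"
    and lim: "x \<longlonglongrightarrow> xstar"
    and sigma_max: "\<sigma>max = \<sigma> 1 + 2 * (L + 3 * \<alpha> * (2 * \<kappa>G + \<kappa>H))"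
    and C: "C = 8 * (L + \<alpha> * \<sigma>max + 2 * \<theta>) / \<mu>\<^sup>2 + 4 * \<alpha> * \<kappa>H * \<zeta> / \<mu>"
    and t1: "t1 \<ge> 1"
    and t1_step: "\<And>t l. t \<ge> t1 \<Longrightarrow> l \<in> std_simplex
               \<Longrightarrow> norm (\<Delta>x (t + 1)) \<le> 4 / \<mu> * norm (weighted_grad F l (x t))"
    and t1_grad: "\<And>t. t \<ge> t1 \<Longrightarrow> norm (g (t + 1)) \<le> C * norm (g t) ^ 2"
  shows "(\<exists>C1>0. \<exists>C2>0. \<exists>C3>0. \<forall>t\<ge>t1.
            norm (x (t + 1) - xstar) \<le> C1 * norm (g (t + 1)) \<and>
            norm (weighted_grad F (lam (t + 1)) (x t))
              \<le> C2 * min (norm (\<Delta>x (t + 1))) (norm (x t - xstar)) \<and>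
            norm (x (t + 1) - xstar) \<le> C3 * norm (g t) * norm (x t - xstar))
         \<and> superlinearly_convergent x xstar"
proof -
  \<comment> \<open>One constant for all objectives: the sum of absolute values dominates each
    \<open>Lj j\<close> and is visibly nonnegative.\<close>
  define K where "K = (\<Sum>j\<in>UNIV. \<bar>Lj j\<bar>)"
  interpret obj: lipschitz_hessian "obj F j" K for j
  proof
    show "twice_cont_differentiable (obj F j)" by (rule C2)
    show "0 \<le> K" by (simp add: K_def sum_nonneg)
    have "Lj j \<le> K"
      unfolding K_def using member_le_sum[of j UNIV "\<lambda>j. \<bar>Lj j\<bar>"] by simp
    then show "opnorm (hessian (obj F j) y - hessian (obj F j) z) \<le> K * norm (y - z)" for y z
      using A1[of j y z] mult_right_mono[of "Lj j" K "norm (y - z)"] by simp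
  qed
  interpret convergent_run F \<theta> \<alpha> \<kappa>G \<kappa>H \<zeta> K x \<sigma> lam it gb Hb xp lp \<mu> xstar t1
  proof
    show "M_CRM F \<theta> \<alpha> \<kappa>G \<kappa>H x \<sigma> lam it gb Hb xp lp" by (rule alg)
    show "gb t i j = gradient (obj F j) (x t)"
      if "t \<ge> 1" "i \<in> inner_iters \<alpha> \<sigma> it t" for t i j
      using that by (rule A4_grad)
    show "opnorm (hessian (obj F j) (x t) - Hb t i j) \<le> \<kappa>H / \<alpha> powi (int i - 1)
        * min (norm (x t - x (t - 1))) (\<zeta> * norm (weighted_grad F (lam t) (x t)))"
      if "t \<ge> 1" "i \<in> inner_iters \<alpha> \<sigma> it t" for t i j
      using A4_hess[OF that] by (simp only: \<Delta>x[OF that(1)] g[OF that(1)])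
    show "norm (x (Suc t) - x t) \<le> 4 / \<mu> * norm (weighted_grad F l (x t))"
      if "t \<ge> t1" "l \<in> std_simplex" for t l
      using t1_step[OF that] \<Delta>x[of "t + 1"] by simp
  qed (use zeta_pos mu_pos lim t1 in auto)
  have "\<Delta>x (t + 1) = x (Suc t) - x t" "g (t + 1) = weighted_grad F (lam (Suc t)) (x (Suc t))" for t
    using \<Delta>x[of "t + 1"] g[of "t + 1"] by simp_all
  moreover have "g t = weighted_grad F (lam t) (x t)" if "t \<ge> t1" for t
    using g that t1 by simp
  ultimately show ?thesis
    using rates superlinear by simp
qed

end
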